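(* Let $V:\mathbb{N}\to\mathbb{R}$ and suppose $$\limsup_{n\to\infty}n|V(n)|=a<\infty .$$ Let $P$ be the set of $E\in(-2,2)$ for which the equation $u(n+1)+u(n-1)+V(n)u(n)=Eu(n)$ ($n\ge1$) has a nontrivial $\ell^2(\mathbb{N})$ solution. Then $P$ is a countable set whose only possible accumulation points are $2$ and $-2$. Moreover, the following estimate holds: $$\sum_{E_i\in P}(4-E_i^2)\le 4a^2+4\min\{1,a\}.$$
   Context: Here $\mathbb{N}=\{1,2,\dots\}$. "Countable" includes finite or empty. $P$ is the collection of eigenvalues in $(-2,2)$ of the half-line discrete Schrödinger operator $(Hu)(n)=u(n+1)+u(n-1)+V(n)u(n)$, $n\ge1$, over all possible boundary conditions at $0$ (no boundary condition is imposed on $u$). *)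

theory Defs
  imports "HOL-Analysis.Analysis"
begin

(* The potential V and the equation live on {1, 2, ...}; V 0 is never used.  The value u 0 is an
   unconstrained part of the solution, as no boundary condition is imposed. *)
definition schrodinger_solution :: "(nat \<Rightarrow> real) \<Rightarrow> real \<Rightarrow> (nat \<Rightarrow> complex) \<Rightarrow> bool" where
  "schrodinger_solution V E u \<longleftrightarrow>
     (\<forall>n\<ge>1. u (n + 1) + u (n - 1) + of_real (V n) * u n = of_real E * u n)"

definition square_summable :: "(nat \<Rightarrow> complex) \<Rightarrow> bool" where
  "square_summable u \<longleftrightarrow> (\<lambda>n. (cmod (u n))\<^sup>2) summable_on {1..}"

definition embedded_eigenvalues :: "(nat \<Rightarrow> real) \<Rightarrow> real set" where
  "embedded_eigenvalues V =
     {E \<in> {-2<..<2}. \<exists>u. schrodinger_solution V E u \<and> square_summable u \<and> (\<exists>n. u n \<noteq> 0)}"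

end

theory Submission
  imports Defs
begin

text \<open>
  Write \<open>E = 2 cos k\<close> with \<open>0 < k < \<pi>\<close> and \<open>e = exp(i k)\<close>.  For a real solution \<open>u\<close> the complex number
  \<open>w(n) = e u(n+1) - u(n)\<close> satisfies
  \<open>w(n+1) = e (w(n) - (V(n+1) / sin k) Im w(n))\<close>, so that the free evolution is a mere rotation.  Split
  \<open>w\<close> into the squared amplitude \<open>R = |w|\<^sup>2\<close> and the squared phase \<open>q = w / cnj w\<close>.  Since
  \<open>V(n) = O(1/n)\<close>, up to errors \<open>O(1/n\<^sup>2)\<close> and \<open>O(1/n)\<close> respectively,
  \<open>ln R(n+1) - ln R(n) = - V(n+1) Im q(n) / sin k\<close> and \<open>q(n+1) = e\<^sup>2 q(n)\<close>
  (lemmas \<open>amplitude_phase_step\<close> and \<open>embedded_eigenvalue_amplitude_phase\<close>).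

  A sequence that rotates in this way by a factor other than 1 sums to a convergent series against
  \<open>1/n\<close> (\<open>summable_rotating_over_Suc\<close>).  Writing products of imaginary parts as real parts of
  products of phases, this makes the sequences \<open>Im q\<close> of different energies orthogonal, each with mean
  square \<open>1/2\<close>, in the sense of logarithmic averages.  The exceptions come from the products with
  rotation factor 1, that is from pairs \<open>E, -E\<close> and from \<open>E = 0\<close>.

  On the other hand, if \<open>u\<close> is square summable then \<open>R\<close> is summable; for finitely many
  eigenvalues there are infinitely many common \<open>n\<close> at which all \<open>R(n) \<le> 1/n\<close>.  Hence, along these \<open>n\<close>, the
  sum of \<open>V Im q / sin k\<close> must be at least \<open>ln n - O(1)\<close> for every one of these eigenvalues.  Multiply by
  \<open>sin\<^sup>2 k\<close> and add: with \<open>f = \<Sum> sin k Im q\<close> and \<open>S = \<Sum> sin\<^sup>2 k\<close>, the sum of \<open>V f\<close> is at least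
  \<open>S ln n - O(1)\<close>.  If \<open>|V(n)| \<le> b/n\<close> then \<open>V f \<le> (f\<^sup>2 + b\<^sup>2/4)/n\<close>, and by orthogonality the sum of
  the right-hand side is \<open>(S/2 + b\<^sup>2/4) ln n + O(1)\<close>.  Therefore \<open>S \<le> b\<^sup>2/2\<close>, and since
  \<open>4 - E\<^sup>2 = 4 sin\<^sup>2 k\<close>, letting \<open>b\<close> decrease to \<open>a\<close> bounds the sum of \<open>4 - E\<^sup>2\<close> by \<open>2 a\<^sup>2\<close>.

  This applies to the positive and to the negative eigenvalues separately, where no resonance
  occurs, and gives \<open>4 a\<^sup>2\<close> together.  The eigenvalue \<open>0\<close> contributes \<open>4\<close>; the trivial bound
  \<open>|Im q| \<le> 1\<close> in the same comparison shows that it can only occur if \<open>a \<ge> 1\<close>, whence the term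
  \<open>4 min 1 a\<close>.  Countability and the location of the accumulation points follow from the
  boundedness of the sums over finite sets of eigenvalues.
\<close>

section \<open>Asymptotic rotations\<close>

text \<open>The modulus of \<open>\<omega>\<close> and of the sequence is fixed at 1 so that the notion is closed under
  products and conjugation, which is how the correlations of two phases are reached.\<close>

definition rotates :: "complex \<Rightarrow> (nat \<Rightarrow> complex) \<Rightarrow> bool" where
  "rotates \<omega> q \<longleftrightarrow> cmod \<omega> = 1 \<and> (\<forall>n. cmod (q n) = 1)
     \<and> (\<exists>K. \<forall>\<^sub>F n in sequentially. cmod (q (Suc n) - \<omega> * q n) \<le> K / real (Suc n))"

lemma summable_inverse_Suc_squared: "summable (\<lambda>n. K / (real (Suc n))\<^sup>2)"
proof -
  have "summable (\<lambda>n. inverse (real (Suc n) ^ 2))"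
    using inverse_power_summable[of 2, where 'a=real] by (subst summable_Suc_iff) simp
  then have "summable (\<lambda>n. K * inverse (real (Suc n) ^ 2))"
    by (rule summable_mult)
  then show ?thesis by (simp add: divide_inverse)
qed

lemma rotates_mult:
  assumes "rotates \<omega> q" "rotates \<rho> r"
  shows "rotates (\<omega> * \<rho>) (\<lambda>n. q n * r n)"
proof -
  obtain K L where
    K: "\<forall>\<^sub>F n in sequentially. cmod (q (Suc n) - \<omega> * q n) \<le> K / real (Suc n)" and
    L: "\<forall>\<^sub>F n in sequentially. cmod (r (Suc n) - \<rho> * r n) \<le> L / real (Suc n)"
    using assms unfolding rotates_def by blast
  have "\<forall>\<^sub>F n in sequentially.
      cmod (q (Suc n) * r (Suc n) - \<omega> * \<rho> * (q n * r n)) \<le> (K + L) / real (Suc n)"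
    using K L
  proof eventually_elim
    case (elim n)
    have "q (Suc n) * r (Suc n) - \<omega> * \<rho> * (q n * r n)
        = (q (Suc n) - \<omega> * q n) * r (Suc n) + \<omega> * q n * (r (Suc n) - \<rho> * r n)"
      by (simp add: algebra_simps)
    also have "cmod \<dots> \<le> cmod ((q (Suc n) - \<omega> * q n) * r (Suc n))
        + cmod (\<omega> * q n * (r (Suc n) - \<rho> * r n))"
      by (rule norm_triangle_ineq)
    also have "\<dots> = cmod (q (Suc n) - \<omega> * q n) + cmod (r (Suc n) - \<rho> * r n)"
      using assms by (simp add: norm_mult rotates_def)
    also have "\<dots> \<le> (K + L) / real (Suc n)"
      using elim by (simp add: add_divide_distrib)
    finally show ?case .
  qed
  then show ?thesis
    using assms by (auto simp: rotates_def norm_mult)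
qed

lemma rotates_cnj:
  assumes "rotates \<omega> q"
  shows "rotates (cnj \<omega>) (\<lambda>n. cnj (q n))"
proof -
  have "cmod (cnj (q (Suc n)) - cnj \<omega> * cnj (q n)) = cmod (q (Suc n) - \<omega> * q n)" for n
    by (metis complex_cnj_diff complex_cnj_mult complex_mod_cnj)
  then show ?thesis using assms by (simp add: rotates_def)
qed

text \<open>Summation by parts in disguise: \<open>(1 - \<omega>) p(n)/(n+1)\<close> is the telescoping difference of
  \<open>p(n)/(n+1)\<close> and \<open>p(n+1)/(n+2)\<close>, up to terms of order \<open>1/n\<^sup>2\<close> that come from replacing
  \<open>n+2\<close> by \<open>n+1\<close> and \<open>p(n+1)\<close> by \<open>\<omega> p(n)\<close>.\<close>

lemma summable_rotating_over_Suc: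
  assumes "rotates \<omega> p" "\<omega> \<noteq> 1"
  shows "summable (\<lambda>n. p n / of_nat (Suc n))"
proof -
  obtain K where p1: "\<And>n. cmod (p n) = 1" and
    K: "\<forall>\<^sub>F n in sequentially. cmod (p (Suc n) - \<omega> * p n) \<le> K / real (Suc n)"
    using assms(1) unfolding rotates_def by blast
  have "(\<lambda>n. p n / of_nat (Suc n)) \<longlonglongrightarrow> 0"
  proof (rule tendsto_norm_zero_cancel)
    show "(\<lambda>n. norm (p n / of_nat (Suc n))) \<longlonglongrightarrow> 0"
      using LIMSEQ_inverse_real_of_nat
      by (simp add: norm_divide p1 inverse_eq_divide del: of_nat_Suc)
  qed
  then have 1: "summable (\<lambda>n. p n / of_nat (Suc n) - p (Suc n) / of_nat (Suc (Suc n)))"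
    by (rule telescope_summable')
  have 2: "summable (\<lambda>n. p (Suc n) / of_nat (Suc (Suc n)) - p (Suc n) / of_nat (Suc n))"
  proof (rule summable_comparison_test_ev[OF _ summable_inverse_Suc_squared[of 1]])
    have "cmod (p (Suc n) / of_nat (Suc (Suc n)) - p (Suc n) / of_nat (Suc n))
        \<le> 1 / (real (Suc n))\<^sup>2" for n
    proof -
      have "p (Suc n) / of_nat (Suc (Suc n)) - p (Suc n) / of_nat (Suc n)
          = p (Suc n) * of_real (1 / real (Suc (Suc n)) - 1 / real (Suc n))"
        by (simp add: algebra_simps del: of_nat_Suc)
      also have "cmod \<dots> = \<bar>1 / real (Suc (Suc n)) - 1 / real (Suc n)\<bar>"
        by (simp only: norm_mult norm_of_real p1) simp
      also have "1 / real (Suc (Suc n)) - 1 / real (Suc n)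
          = - (1 / (real (Suc n) * real (Suc (Suc n))))"
        by (simp add: divide_simps)
      also have "\<bar>- (1 / (real (Suc n) * real (Suc (Suc n))))\<bar>
          = 1 / (real (Suc n) * real (Suc (Suc n)))"
        by (simp del: of_nat_Suc)
      also have "\<dots> \<le> 1 / (real (Suc n))\<^sup>2"
        unfolding power2_eq_square by (intro divide_left_mono mult_left_mono) auto
      finally show ?thesis .
    qed
    then show "\<forall>\<^sub>F n in sequentially.
        norm (p (Suc n) / of_nat (Suc (Suc n)) - p (Suc n) / of_nat (Suc n)) \<le> 1 / (real (Suc n))\<^sup>2"
      by simp
  qed
  have 3: "summable (\<lambda>n. (p (Suc n) - \<omega> * p n) / of_nat (Suc n))"
  proof (rule summable_comparison_test_ev[OF _ summable_inverse_Suc_squared[of K]])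
    show "\<forall>\<^sub>F n in sequentially.
        norm ((p (Suc n) - \<omega> * p n) / of_nat (Suc n)) \<le> K / (real (Suc n))\<^sup>2"
      using K
    proof eventually_elim
      case (elim n)
      have "norm ((p (Suc n) - \<omega> * p n) / of_nat (Suc n))
          = cmod (p (Suc n) - \<omega> * p n) / real (Suc n)"
        by (simp only: norm_divide norm_of_nat)
      also have "\<dots> \<le> K / real (Suc n) / real (Suc n)"
        using elim by (rule divide_right_mono) simp
      finally show ?case by (simp add: power2_eq_square)
    qed
  qed
  have "summable (\<lambda>n. (1 - \<omega>) * (p n / of_nat (Suc n)))"
    using summable_add[OF summable_add[OF 1 2] 3]
    by (simp add: algebra_simps diff_divide_distrib del: of_nat_Suc)
  then have "summable (\<lambda>n. inverse (1 - \<omega>) * ((1 - \<omega>) * (p n / of_nat (Suc n))))"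
    by (rule summable_mult)
  moreover have "inverse (1 - \<omega>) * ((1 - \<omega>) * z) = z" for z
    using assms(2) by (simp flip: mult.assoc)
  ultimately show ?thesis by simp
qed

text \<open>Asymptotic orthogonality: \<open>Im q Im r = (Re (q cnj r) - Re (q r)) / 2\<close>, where the two products
  rotate by \<open>\<omega> cnj \<rho>\<close> and \<open>\<omega> \<rho>\<close>, both different from 1.\<close>

lemma summable_Im_mult_Im:
  assumes q: "rotates \<omega> q" and r: "rotates \<rho> r" and "\<omega> \<noteq> \<rho>" "\<omega> * \<rho> \<noteq> 1"
  shows "summable (\<lambda>n. Im (q n) * Im (r n) / real (Suc n))"
proof -
  have "\<omega> * cnj \<rho> \<noteq> 1"
  proof
    assume "\<omega> * cnj \<rho> = 1"
    moreover have "cnj \<rho> * \<rho> = 1"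
      using r complex_norm_square[of \<rho>] by (simp add: rotates_def mult.commute)
    ultimately show False using \<open>\<omega> \<noteq> \<rho>\<close> by (metis mult.assoc mult_1 mult.right_neutral)
  qed
  then have "summable (\<lambda>n. q n * cnj (r n) / of_nat (Suc n))"
    using summable_rotating_over_Suc[OF rotates_mult[OF q rotates_cnj[OF r]]] by simp
  moreover have "summable (\<lambda>n. q n * r n / of_nat (Suc n))"
    using summable_rotating_over_Suc[OF rotates_mult[OF q r]] assms(4) by simp
  ultimately have "summable (\<lambda>n. Re (q n * cnj (r n) / of_nat (Suc n) - q n * r n / of_nat (Suc n)))"
    by (intro summable_Re summable_diff)
  then have "summable (\<lambda>n. (1/2) *
      Re (q n * cnj (r n) / of_nat (Suc n) - q n * r n / of_nat (Suc n)))"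
    by (rule summable_mult)
  moreover have "(1/2) * Re (q n * cnj (r n) / of_nat (Suc n) - q n * r n / of_nat (Suc n))
      = Im (q n) * Im (r n) / real (Suc n)" for n
    by (simp add: Re_divide_of_nat field_simps del: of_nat_Suc)
  ultimately show ?thesis by (simp only:)
qed

text \<open>The diagonal counterpart: \<open>(Im q)\<^sup>2 = (1 - Re (q\<^sup>2)) / 2\<close> has mean \<open>1/2\<close>, and its
  oscillating part rotates by \<open>\<omega>\<^sup>2\<close>.\<close>

lemma summable_Im_squared:
  assumes q: "rotates \<omega> q" and "\<omega>\<^sup>2 \<noteq> 1"
  shows "summable (\<lambda>n. ((Im (q n))\<^sup>2 - 1 / 2) / real (Suc n))"
proof -
  have "summable (\<lambda>n. q n * q n / of_nat (Suc n))"
    using summable_rotating_over_Suc[OF rotates_mult[OF q q]] assms(2)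
    by (simp add: power2_eq_square)
  then have "summable (\<lambda>n. (-1/2) * Re (q n * q n / of_nat (Suc n)))"
    by (intro summable_mult summable_Re)
  moreover have "(-1/2) * Re (q n * q n / of_nat (Suc n))
      = ((Im (q n))\<^sup>2 - 1 / 2) / real (Suc n)" for n
  proof -
    have "(Re (q n))\<^sup>2 + (Im (q n))\<^sup>2 = 1"
      using q cmod_power2[of "q n"] by (simp add: rotates_def)
    moreover have "Re (q n * q n) = (Re (q n))\<^sup>2 - (Im (q n))\<^sup>2"
      by (simp add: power2_eq_square)
    ultimately have "(-1/2) * Re (q n * q n) = (Im (q n))\<^sup>2 - 1 / 2"
      by linarith
    then show ?thesis
      by (simp only: Re_divide_of_nat times_divide_eq_right)
  qed
  ultimately show ?thesis by simp
qed

text \<open>Expanding the square, the off-diagonal terms cancel and each diagonal one leaves the mean \<open>1/2\<close>.\<close>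

lemma summable_square_of_combination:
  fixes t :: "'i \<Rightarrow> real"
  assumes F: "finite F" and rot: "\<And>i. i \<in> F \<Longrightarrow> rotates (\<omega> i) (q i)"
    and inj: "inj_on \<omega> F" and nonres: "\<And>i j. i \<in> F \<Longrightarrow> j \<in> F \<Longrightarrow> \<omega> i * \<omega> j \<noteq> 1"
  shows "summable (\<lambda>n. ((\<Sum>i\<in>F. t i * Im (q i n))\<^sup>2 - (\<Sum>i\<in>F. (t i)\<^sup>2) / 2) / real (Suc n))"
proof -
  have eq: "((\<Sum>i\<in>F. t i * Im (q i n))\<^sup>2 - (\<Sum>i\<in>F. (t i)\<^sup>2) / 2) / real (Suc n)
      = (\<Sum>i\<in>F. \<Sum>j\<in>F. t i * t j *
          ((Im (q i n) * Im (q j n) - (if j = i then 1 / 2 else 0)) / real (Suc n)))" for n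
  proof -
    have "(\<Sum>i\<in>F. \<Sum>j\<in>F. t i * t j *
          ((Im (q i n) * Im (q j n) - (if j = i then 1 / 2 else 0)) / real (Suc n)))
      = (\<Sum>i\<in>F. \<Sum>j\<in>F. (t i * Im (q i n)) * (t j * Im (q j n)) / real (Suc n)
          - (if j = i then t i * t j / 2 / real (Suc n) else 0))"
      by (intro sum.cong refl) (simp add: field_simps del: of_nat_Suc)
    also have "\<dots> = (\<Sum>i\<in>F. \<Sum>j\<in>F. (t i * Im (q i n)) * (t j * Im (q j n)) / real (Suc n))
        - (\<Sum>i\<in>F. (t i)\<^sup>2 / 2 / real (Suc n))"
      by (simp only: sum_subtractf) (simp add: F power2_eq_square del: of_nat_Suc)
    finally show ?thesis
      by (simp add: power2_eq_square sum_product diff_divide_distrib sum_divide_distrib del: of_nat_Suc)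
  qed
  have "summable (\<lambda>n. (Im (q i n) * Im (q j n) - (if j = i then 1 / 2 else 0)) / real (Suc n))"
    if "i \<in> F" "j \<in> F" for i j
  proof (cases "j = i")
    case True
    then show ?thesis
      using summable_Im_squared[OF rot[OF that(1)]] nonres[OF that(1) that(1)]
      by (simp add: power2_eq_square)
  next
    case False
    then have "\<omega> i \<noteq> \<omega> j" using inj that by (auto dest: inj_onD)
    then show ?thesis
      using summable_Im_mult_Im[OF rot[OF that(1)] rot[OF that(2)] _ nonres[OF that]] False by simp
  qed
  then show ?thesis
    unfolding eq by (intro summable_sum summable_mult)
qed

section \<open>Amplitude and phase of a solution\<close>

text \<open>The number \<open>exp(i k)\<close> with \<open>E = 2 cos k\<close> and \<open>0 < k < \<pi>\<close>: the multiplier of the free Bloch wave.\<close>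

definition bloch :: "real \<Rightarrow> complex" where
  "bloch E = Complex (E / 2) (sqrt (4 - E\<^sup>2) / 2)"

lemma bloch_spectral:
  assumes "E \<in> {-2<..<2}"
  shows norm_bloch: "cmod (bloch E) = 1"
    and Im_bloch_pos: "Im (bloch E) > 0"
    and Im_bloch_squared: "4 * (Im (bloch E))\<^sup>2 = 4 - E\<^sup>2"
    and bloch_quadratic: "(bloch E)\<^sup>2 = of_real E * bloch E - 1"
proof -
  have "\<bar>E\<bar> < 2" using assms by auto
  then have E: "E\<^sup>2 < 4" using abs_square_less_1[of "E / 2"] by (simp add: power_divide)
  show "Im (bloch E) > 0" using E by (simp add: bloch_def)
  show *: "4 * (Im (bloch E))\<^sup>2 = 4 - E\<^sup>2" using E by (simp add: bloch_def power_divide)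
  have "(cmod (bloch E))\<^sup>2 = 1" using * by (simp add: cmod_power2) (simp add: bloch_def power_divide diff_divide_distrib)
  then show "cmod (bloch E) = 1" by (metis norm_ge_zero one_power2 power2_eq_imp_eq zero_le_one)
  show "(bloch E)\<^sup>2 = of_real E * bloch E - 1"
    using * by (simp add: complex_eq_iff power2_eq_square) (simp add: bloch_def field_simps)
qed

text \<open>As \<open>V\<close> and \<open>E\<close> are real, the real and the imaginary part of a solution are again solutions, and
  one of them is nontrivial.\<close>

lemma embedded_eigenvalue_real_solution:
  assumes "E \<in> embedded_eigenvalues V"
  obtains v :: "nat \<Rightarrow> real" where
    "\<And>n. v (Suc (Suc n)) = (E - V (Suc n)) * v (Suc n) - v n"
    "summable (\<lambda>n. (v (Suc n))\<^sup>2)" "\<exists>n. v n \<noteq> 0"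
proof -
  note solution = that
  obtain u n0 where u: "schrodinger_solution V E u" "square_summable u" and n0: "u n0 \<noteq> 0"
    using assms unfolding embedded_eigenvalues_def by blast
  have "(\<lambda>n. (cmod (u (Suc n)))\<^sup>2) summable_on UNIV"
  proof -
    have "bij_betw Suc UNIV {1..}"
      by (rule bij_betwI[where g="\<lambda>n. n - 1"]) auto
    then show ?thesis
      using u(2) unfolding square_summable_def by (subst summable_on_reindex_bij_betw) auto
  qed
  then have sq: "summable (\<lambda>n. (cmod (u (Suc n)))\<^sup>2)"
    by (rule summable_on_imp_summable)
  have rec: "u (Suc (Suc n)) = of_real (E - V (Suc n)) * u (Suc n) - u n" for n
    using u(1) unfolding schrodinger_solution_def
    by (auto dest!: spec[of _ "Suc n"] simp: algebra_simps)
  have part: thesis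
    if g: "g = Re \<or> g = Im" and ne: "g (u n0) \<noteq> 0" for g
  proof (rule solution)
    show "g (u (Suc (Suc n))) = (E - V (Suc n)) * g (u (Suc n)) - g (u n)" for n
      using g by (auto simp: rec)
    have "norm ((g (u (Suc n)))\<^sup>2) \<le> (cmod (u (Suc n)))\<^sup>2" for n
      using g by (auto simp: cmod_power2)
    then show "summable (\<lambda>n. (g (u (Suc n)))\<^sup>2)"
      by (intro summable_comparison_test'[OF sq]) auto
    show "\<exists>n. g (u n) \<noteq> 0" using ne by blast
  qed
  show thesis
    using part[of Re] part[of Im] n0 by (auto simp: complex_eq_iff)
qed

text \<open>Besides the rotation by \<open>e\<close>, the step multiplies \<open>w\<close> by \<open>1 - \<delta>\<close> with \<open>|\<delta>| \<le> |x|\<close>; this changes \<open>w / cnj w\<close> by a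
  factor \<open>1 + O(|x|)\<close>, and \<open>|w|\<^sup>2\<close> by the factor
  \<open>1 - x Im (w / cnj w) + x\<^sup>2 (Im w)\<^sup>2 / |w|\<^sup>2\<close>, whose logarithm is expanded to first order in \<open>x\<close>.\<close>

lemma amplitude_phase_step:
  fixes w w' e :: complex and x :: real
  assumes "w \<noteq> 0" "cmod e = 1" "\<bar>x\<bar> \<le> 1 / 4" and w': "w' = e * (w - of_real (x * Im w))"
  shows "cmod (w' / cnj w' - e\<^sup>2 * (w / cnj w)) \<le> 4 * \<bar>x\<bar>"
    and "\<bar>ln ((cmod w')\<^sup>2) - ln ((cmod w)\<^sup>2) + x * Im (w / cnj w)\<bar> \<le> 9 * x\<^sup>2"
proof -
  define \<delta> where "\<delta> = of_real (x * Im w) / w"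
  have wd: "w - of_real (x * Im w) = w * (1 - \<delta>)"
    using assms(1) by (simp add: \<delta>_def algebra_simps)
  have \<delta>: "cmod \<delta> \<le> \<bar>x\<bar>"
    using assms(1) mult_left_mono[OF abs_Im_le_cmod[of w], of "\<bar>x\<bar>"]
    by (simp add: \<delta>_def norm_divide norm_mult divide_le_eq)
  have d: "cmod (1 - \<delta>) \<ge> 1 / 2"
    using norm_triangle_ineq2[of 1 \<delta>] \<delta> assms(3) by simp
  then have d0: "1 - \<delta> \<noteq> 0" by auto
  then have d1: "cnj (1 - \<delta>) \<noteq> 0" by (metis complex_cnj_zero_iff)
  have e0: "cnj e * e = 1"
    using assms(2) complex_norm_square[of e] by (simp add: mult.commute)
  then have ei: "1 / cnj e = e" by (metis divide_eq_eq mult.commute mult_zero_left zero_neq_one)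
  have "w' / cnj w' = e * (1 / cnj e) * (w / cnj w) * ((1 - \<delta>) / cnj (1 - \<delta>))"
    unfolding w' wd by (simp add: mult.assoc)
  also have "\<dots> = e\<^sup>2 * (w / cnj w) * ((1 - \<delta>) / cnj (1 - \<delta>))"
    unfolding ei by (simp add: power2_eq_square)
  finally have "w' / cnj w' - e\<^sup>2 * (w / cnj w)
      = e\<^sup>2 * (w / cnj w) * ((1 - \<delta>) / cnj (1 - \<delta>) - 1)"
    by (simp only: right_diff_distrib mult_1_right)
  also have "(1 - \<delta>) / cnj (1 - \<delta>) - 1 = (cnj \<delta> - \<delta>) / cnj (1 - \<delta>)"
    using d1 by (simp add: field_simps)
  also have "cmod (e\<^sup>2 * (w / cnj w) * ((cnj \<delta> - \<delta>) / cnj (1 - \<delta>)))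
      = cmod (cnj \<delta> - \<delta>) / cmod (1 - \<delta>)"
    using assms(1,2) by (simp only: norm_mult norm_divide norm_power complex_mod_cnj) simp
  also have "\<dots> \<le> (2 * \<bar>x\<bar>) / (1 / 2)"
    using norm_triangle_ineq4[of "cnj \<delta>" \<delta>] \<delta> d by (intro frac_le) auto
  finally show "cmod (w' / cnj w' - e\<^sup>2 * (w / cnj w)) \<le> 4 * \<bar>x\<bar>" by simp

  define s where "s = (Im w)\<^sup>2 / (cmod w)\<^sup>2"
  define y where "y = - x * Im (w / cnj w) + x\<^sup>2 * s"
  have "(Im w)\<^sup>2 \<le> (cmod w)\<^sup>2" by (simp add: cmod_power2)
  then have s: "0 \<le> s" "s \<le> 1"
    using assms(1) by (simp_all add: s_def)
  have q: "\<bar>Im (w / cnj w)\<bar> \<le> 1"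
    using abs_Im_le_cmod[of "w / cnj w"] assms(1) by (simp add: norm_divide)
  have x2: "x\<^sup>2 \<le> \<bar>x\<bar>"
    using assms(3) mult_left_mono[of "\<bar>x\<bar>" 1 "\<bar>x\<bar>"] by (simp add: power2_eq_square abs_mult_self_eq)
  have s2: "0 \<le> x\<^sup>2 * s" "x\<^sup>2 * s \<le> x\<^sup>2"
    using s mult_left_mono[of s 1 "x\<^sup>2"] by auto
  have "\<bar>x * Im (w / cnj w)\<bar> \<le> \<bar>x\<bar>"
    using mult_left_mono[OF q, of "\<bar>x\<bar>"] by (simp add: abs_mult)
  then have y: "\<bar>y\<bar> \<le> 2 * \<bar>x\<bar>"
    using s2 x2 unfolding y_def by linarith
  have "(cmod w')\<^sup>2 = (cmod (w - of_real (x * Im w)))\<^sup>2"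
    using assms(2) by (simp add: w' norm_mult)
  also have "\<dots> = (cmod w)\<^sup>2 - 2 * x * (Re w * Im w) + x\<^sup>2 * (Im w)\<^sup>2"
    by (simp add: cmod_power2) (simp add: power2_eq_square algebra_simps)
  also have "\<dots> = (cmod w)\<^sup>2 * (1 + y)"
  proof -
    have "Im (w / cnj w) = 2 * (Re w * Im w) / (cmod w)\<^sup>2"
      by (simp add: Im_divide cmod_power2)
    then show ?thesis
      using assms(1) by (simp add: y_def s_def field_simps)
  qed
  finally have "ln ((cmod w')\<^sup>2) = ln ((cmod w)\<^sup>2) + ln (1 + y)"
    using y assms(1,3) by (simp add: ln_mult)
  moreover have "\<bar>ln (1 + y) - y\<bar> \<le> 2 * y\<^sup>2"
    using y assms(3) by (intro abs_ln_one_plus_x_minus_x_bound) auto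
  moreover have "y\<^sup>2 \<le> 4 * x\<^sup>2"
    using power_mono[OF y, of 2] by (simp add: power_mult_distrib)
  ultimately show "\<bar>ln ((cmod w')\<^sup>2) - ln ((cmod w)\<^sup>2) + x * Im (w / cnj w)\<bar> \<le> 9 * x\<^sup>2"
    using s2 unfolding y_def by linarith
qed

text \<open>The index is shifted by one with respect to the equation: step \<open>n\<close> to \<open>n + 1\<close> uses the equation
  at the site \<open>n + 1\<close>, so that sequences may start at 0 although \<open>V\<close> starts at 1.\<close>

definition amplitude_phase ::
    "(nat \<Rightarrow> real) \<Rightarrow> real \<Rightarrow> (nat \<Rightarrow> real) \<Rightarrow> (nat \<Rightarrow> complex) \<Rightarrow> bool" where
  "amplitude_phase V E R q \<longleftrightarrow> (\<forall>n. R n > 0) \<and> summable R \<and> rotates ((bloch E)\<^sup>2) q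
     \<and> summable (\<lambda>n. ln (R (Suc n)) - ln (R n) + V (Suc n) / Im (bloch E) * Im (q n))"

lemma embedded_eigenvalue_amplitude_phase:
  assumes E: "E \<in> embedded_eigenvalues V"
    and V: "\<forall>\<^sub>F n in sequentially. \<bar>V (Suc n)\<bar> \<le> b / real (Suc n)"
  shows "\<exists>R q. amplitude_phase V E R q"
proof -
  have E2: "E \<in> {-2<..<2}" using E by (simp add: embedded_eigenvalues_def)
  define e where "e = bloch E"
  define t where "t = Im e"
  have e1: "cmod e = 1" and t: "t > 0" and e2: "e\<^sup>2 = of_real E * e - 1"
    using bloch_spectral[OF E2] by (simp_all add: e_def t_def)
  have e0: "e \<noteq> 0" using e1 by auto
  obtain v where rec: "\<And>n. v (Suc (Suc n)) = (E - V (Suc n)) * v (Suc n) - v n"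
    and sq: "summable (\<lambda>n. (v (Suc n))\<^sup>2)" and nz: "\<exists>n. v n \<noteq> 0"
    using embedded_eigenvalue_real_solution[OF E] by blast
  define x where "x n = V (Suc n) / t" for n
  define w where "w n = e * of_real (v (Suc n)) - of_real (v n)" for n
  have Im_w: "Im (w n) = t * v (Suc n)" for n
    by (simp add: w_def t_def)
  have step: "w (Suc n) = e * (w n - of_real (x n * Im (w n)))" for n
  proof -
    have "e * (w n - of_real (x n * Im (w n)))
        = e\<^sup>2 * of_real (v (Suc n)) - e * of_real (v n) - e * of_real (V (Suc n) * v (Suc n))"
      using t unfolding Im_w by (simp add: w_def x_def algebra_simps power2_eq_square)
    also have "\<dots> = w (Suc n)"
      by (simp add: e2 w_def rec algebra_simps)
    finally show ?thesis by simp
  qed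
  have w_Suc_zero: "w (Suc n) = 0 \<longleftrightarrow> w n = 0" for n
  proof -
    have "w (Suc n) = 0 \<longleftrightarrow> w n - of_real (x n * Im (w n)) = 0"
      using e0 by (simp add: step)
    also have "\<dots> \<longleftrightarrow> w n = 0" by (auto simp: complex_eq_iff)
    finally show ?thesis .
  qed
  \<comment> \<open>The transfer map is invertible, so that \<open>w\<close> vanishes nowhere unless it vanishes
      identically; the quotients and logarithms below are therefore meaningful for all \<open>n\<close>.\<close>
  have w_nz: "w n \<noteq> 0" for n
  proof
    assume "w n = 0"
    have "w m = 0 \<longleftrightarrow> w 0 = 0" for m
      by (induction m) (simp_all add: w_Suc_zero)
    then have w0: "w m = 0" for m using \<open>w n = 0\<close> by blast
    have "v (Suc m) = 0" for m using Im_w[of m] w0[of m] t by simp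
    moreover from this have "v m = 0" for m using w0[of m] by (simp add: w_def)
    ultimately show False using nz by blast
  qed
  define R where "R n = (cmod (w n))\<^sup>2" for n
  define q where "q n = w n / cnj (w n)" for n
  have x_le: "\<forall>\<^sub>F n in sequentially. \<bar>x n\<bar> \<le> (b / t) / real (Suc n)"
    using V
  proof eventually_elim
    case (elim n)
    then have "\<bar>V (Suc n)\<bar> / t \<le> b / real (Suc n) / t"
      using t by (intro divide_right_mono) auto
    then show ?case using t by (simp add: x_def mult.commute)
  qed
  have "(\<lambda>n. (b / t) * (1 / real (Suc n))) \<longlonglongrightarrow> (b / t) * 0"
    using LIMSEQ_inverse_real_of_nat by (intro tendsto_mult tendsto_const) (simp add: inverse_eq_divide)
  then have "(\<lambda>n. (b / t) / real (Suc n)) \<longlonglongrightarrow> 0" by simp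
  then have "\<forall>\<^sub>F n in sequentially. (b / t) / real (Suc n) < 1 / 4"
    by (rule order_tendstoD(2)) simp
  then have x_small: "\<forall>\<^sub>F n in sequentially. \<bar>x n\<bar> \<le> 1 / 4"
    using x_le by eventually_elim linarith
  have "amplitude_phase V E R q"
    unfolding amplitude_phase_def
  proof (intro conjI allI)
    show "R n > 0" for n by (simp add: R_def w_nz)
    have "summable (\<lambda>n. 2 * (v (Suc (Suc n)))\<^sup>2 + 2 * (v (Suc n))\<^sup>2)"
      using sq by (intro summable_add summable_mult) (subst summable_Suc_iff)
    then have "summable (\<lambda>n. R (Suc n))"
    proof (rule summable_comparison_test')
      fix n
      have "cmod (w (Suc n)) \<le> \<bar>v (Suc (Suc n))\<bar> + \<bar>v (Suc n)\<bar>"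
        unfolding w_def by (rule order_trans[OF norm_triangle_ineq4]) (simp add: norm_mult e1)
      then have "R (Suc n) \<le> (\<bar>v (Suc (Suc n))\<bar> + \<bar>v (Suc n)\<bar>)\<^sup>2"
        unfolding R_def by (rule power_mono) simp
      also have "\<dots> \<le> 2 * (v (Suc (Suc n)))\<^sup>2 + 2 * (v (Suc n))\<^sup>2"
        using sum_squares_bound[of "\<bar>v (Suc (Suc n))\<bar>" "\<bar>v (Suc n)\<bar>"]
        by (simp add: power2_sum)
      finally show "norm (R (Suc n)) \<le> 2 * (v (Suc (Suc n)))\<^sup>2 + 2 * (v (Suc n))\<^sup>2"
        by (simp add: R_def)
    qed
    then show "summable R" by (simp add: summable_Suc_iff)
    show "rotates ((bloch E)\<^sup>2) q"
      unfolding rotates_def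
    proof (intro conjI allI exI)
      show "cmod ((bloch E)\<^sup>2) = 1" using e1 by (simp add: e_def norm_power)
      show "cmod (q n) = 1" for n using w_nz by (simp add: q_def norm_divide)
      show "\<forall>\<^sub>F n in sequentially.
          cmod (q (Suc n) - (bloch E)\<^sup>2 * q n) \<le> (4 * (b / t)) / real (Suc n)"
        using x_le x_small
      proof eventually_elim
        case (elim n)
        then show ?case
          using amplitude_phase_step(1)[OF w_nz e1 elim(2) step]
          by (simp add: q_def e_def)
      qed
    qed
    show "summable (\<lambda>n. ln (R (Suc n)) - ln (R n) + V (Suc n) / Im (bloch E) * Im (q n))"
    proof (rule summable_comparison_test_ev[OF _ summable_inverse_Suc_squared[of "9 * (b / t)\<^sup>2"]])
      show "\<forall>\<^sub>F n in sequentially.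
          norm (ln (R (Suc n)) - ln (R n) + V (Suc n) / Im (bloch E) * Im (q n))
            \<le> 9 * (b / t)\<^sup>2 / (real (Suc n))\<^sup>2"
        using x_le x_small
      proof eventually_elim
        case (elim n)
        have "norm (ln (R (Suc n)) - ln (R n) + V (Suc n) / Im (bloch E) * Im (q n)) \<le> 9 * (x n)\<^sup>2"
          using amplitude_phase_step(2)[OF w_nz e1 elim(2) step]
          by (simp add: R_def q_def x_def t_def e_def)
        also have "(x n)\<^sup>2 \<le> ((b / t) / real (Suc n))\<^sup>2"
          using power_mono[OF elim(1), of 2] by simp
        finally show ?case by (simp add: power_divide power_mult_distrib)
      qed
    qed
  qed
  then show ?thesis by blast
qed

section \<open>Decay rate against the potential\<close>

lemma summable_ln_step_minus_inverse:
  "summable (\<lambda>n. ln (real (Suc (Suc n))) - ln (real (Suc n)) - 1 / real (Suc n))"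
proof (rule summable_comparison_test_ev[OF _ summable_inverse_Suc_squared[of 2]])
  have "norm (ln (real (Suc (Suc n))) - ln (real (Suc n)) - 1 / real (Suc n)) \<le> 2 / (real (Suc n))\<^sup>2"
    if "n \<ge> 1" for n
  proof -
    have "real (Suc (Suc n)) = real (Suc n) * (1 + 1 / real (Suc n))"
      by (simp add: field_simps)
    then have "ln (real (Suc (Suc n))) = ln (real (Suc n)) + ln (1 + 1 / real (Suc n))"
      using ln_mult_pos[of "real (Suc n)" "1 + 1 / real (Suc n)"] by (simp add: add_pos_nonneg)
    moreover have "\<bar>ln (1 + 1 / real (Suc n)) - 1 / real (Suc n)\<bar> \<le> 2 * (1 / real (Suc n))\<^sup>2"
      using that by (intro abs_ln_one_plus_x_minus_x_bound) simp
    ultimately show ?thesis by (simp add: power_divide)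
  qed
  then show "\<forall>\<^sub>F n in sequentially.
      norm (ln (real (Suc (Suc n))) - ln (real (Suc n)) - 1 / real (Suc n)) \<le> 2 / (real (Suc n))\<^sup>2"
    unfolding eventually_sequentially by blast
qed

text \<open>Otherwise the harmonic series would converge.\<close>

lemma summable_frequently_le_inverse:
  fixes R :: "nat \<Rightarrow> real"
  assumes "summable R"
  shows "\<exists>\<^sub>F n in sequentially. R n \<le> 1 / real (Suc n)"
proof (rule ccontr)
  assume "\<not> (\<exists>\<^sub>F n in sequentially. R n \<le> 1 / real (Suc n))"
  then have "\<forall>\<^sub>F n in sequentially. norm (inverse (real (Suc n))) \<le> R n"
    unfolding not_frequently by eventually_elim (simp add: inverse_eq_divide)
  then have "summable (\<lambda>n. inverse (real (Suc n)))"
    by (rule summable_comparison_test_ev) fact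
  then have "summable (\<lambda>n. inverse (real n))"
    by (subst (asm) summable_Suc_iff)
  then show False using not_summable_harmonic by blast
qed

lemma bounded_below_of_summable_increments:
  fixes A h :: "nat \<Rightarrow> real"
  assumes "summable h" "\<forall>\<^sub>F n in sequentially. h n \<le> A (Suc n) - A n"
  shows "\<exists>C. \<forall>\<^sub>F n in sequentially. C \<le> A n"
proof -
  obtain N where N: "\<And>n. n \<ge> N \<Longrightarrow> h n \<le> A (Suc n) - A n"
    using assms(2) unfolding eventually_sequentially by blast
  define S where "S n = (\<Sum>k<n. h k)" for n
  have "Bseq S"
    using assms(1) unfolding S_def summable_iff_convergent by (rule convergent_imp_Bseq)
  then obtain B where B: "\<And>n. \<bar>S n\<bar> \<le> B" unfolding Bseq_def by auto
  have mono: "A N - S N \<le> A n - S n" if "n \<ge> N" for n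
    using that
  proof (induction n rule: dec_induct)
    case (step n)
    then show ?case using N[of n] by (simp add: S_def)
  qed simp
  have "A N - S N - B \<le> A n" if "n \<ge> N" for n
    using mono[OF that] B[of n] by linarith
  then show ?thesis unfolding eventually_sequentially by blast
qed

text \<open>The comparison on which both eigenvalue estimates rest.  The quantity \<open>A\<close>, a weighted sum of the
  logarithms of the amplitudes plus \<open>c ln n\<close>, has increments that are at least a summable sequence, so
  it is bounded below.  At the infinitely many \<open>n\<close> where the sum of the amplitudes, and hence each of
  them, is at most \<open>1/n\<close>, it is at most \<open>(c - \<Sum> s) ln n\<close>.  This forces \<open>\<Sum> s \<le> c\<close>.\<close>

lemma sum_weights_le_of_decaying_amplitudes:
  fixes R d :: "'i \<Rightarrow> nat \<Rightarrow> real" and s :: "'i \<Rightarrow> real"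
  assumes F: "finite F"
    and pos: "\<And>i n. i \<in> F \<Longrightarrow> R i n > 0" and sR: "\<And>i. i \<in> F \<Longrightarrow> summable (R i)"
    and sd: "\<And>i. i \<in> F \<Longrightarrow> summable (\<lambda>n. ln (R i (Suc n)) - ln (R i n) + d i n)"
    and s: "\<And>i. i \<in> F \<Longrightarrow> s i \<ge> 0"
    and g: "\<forall>\<^sub>F n in sequentially. (\<Sum>i\<in>F. s i * d i n) \<le> g n"
    and c: "summable (\<lambda>n. g n - c / real (Suc n))"
  shows "(\<Sum>i\<in>F. s i) \<le> c"
proof (rule ccontr)
  assume neg: "\<not> (\<Sum>i\<in>F. s i) \<le> c"
  define A where "A n = (\<Sum>i\<in>F. s i * ln (R i n)) + c * ln (real (Suc n))" for n
  define h where "h n = (\<Sum>i\<in>F. s i * (ln (R i (Suc n)) - ln (R i n) + d i n))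
      + c * (ln (real (Suc (Suc n))) - ln (real (Suc n)) - 1 / real (Suc n))
      - (g n - c / real (Suc n))" for n
  have "summable h"
    unfolding h_def
    by (intro summable_add summable_diff summable_sum summable_mult sd c summable_ln_step_minus_inverse)
  moreover have "\<forall>\<^sub>F n in sequentially. h n \<le> A (Suc n) - A n"
    using g
  proof eventually_elim
    case (elim n)
    have "A (Suc n) - A n - h n = g n - (\<Sum>i\<in>F. s i * d i n)"
      unfolding A_def h_def
      by (simp add: sum.distrib sum_subtractf algebra_simps del: of_nat_Suc)
    then show ?case using elim by simp
  qed
  ultimately obtain C where C: "\<forall>\<^sub>F n in sequentially. C \<le> A n"
    using bounded_below_of_summable_increments by blast
  have "filterlim (\<lambda>n. ln (real (Suc n))) at_top sequentially"
    by (intro filterlim_compose[OF ln_at_top] filterlim_compose[OF filterlim_real_sequentially filterlim_Suc])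
  then have "\<forall>\<^sub>F n in sequentially. ln (real (Suc n)) > - C / ((\<Sum>i\<in>F. s i) - c)"
    by (simp add: filterlim_at_top_dense)
  then have large: "\<forall>\<^sub>F n in sequentially. (c - (\<Sum>i\<in>F. s i)) * ln (real (Suc n)) < C"
  proof eventually_elim
    case (elim n)
    then have "- C < ln (real (Suc n)) * ((\<Sum>i\<in>F. s i) - c)"
      using neg by (subst (asm) pos_divide_less_eq) auto
    then show ?case by (simp add: algebra_simps)
  qed
  have "\<exists>\<^sub>F n in sequentially. (\<Sum>i\<in>F. R i n) \<le> 1 / real (Suc n)"
    by (intro summable_frequently_le_inverse summable_sum sR)
  then have "\<exists>\<^sub>F n in sequentially. (C \<le> A n \<and> (c - (\<Sum>i\<in>F. s i)) * ln (real (Suc n)) < C)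
      \<and> (\<Sum>i\<in>F. R i n) \<le> 1 / real (Suc n)"
    using frequently_eventually_conj[OF _ eventually_conj[OF C large]] by blast
  then obtain n where *: "C \<le> A n" "(c - (\<Sum>i\<in>F. s i)) * ln (real (Suc n)) < C"
      "(\<Sum>i\<in>F. R i n) \<le> 1 / real (Suc n)"
    using frequently_ex by blast
  have "s i * ln (R i n) \<le> s i * - ln (real (Suc n))" if "i \<in> F" for i
  proof (rule mult_left_mono[OF _ s[OF that]])
    have "R i n \<le> (\<Sum>i\<in>F. R i n)"
      using F pos that by (intro member_le_sum) (auto intro: less_imp_le)
    then have "R i n \<le> 1 / real (Suc n)" using * by linarith
    then have "ln (R i n) \<le> ln (1 / real (Suc n))"
      using pos[OF that] by (intro ln_mono) auto
    then show "ln (R i n) \<le> - ln (real (Suc n))" by (simp add: ln_div del: of_nat_Suc)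
  qed
  then have "(\<Sum>i\<in>F. s i * ln (R i n)) \<le> (\<Sum>i\<in>F. s i * - ln (real (Suc n)))"
    by (rule sum_mono)
  also have "\<dots> = - (\<Sum>i\<in>F. s i) * ln (real (Suc n))"
    by (simp add: sum_distrib_right sum_negf del: of_nat_Suc)
  finally have "A n \<le> (c - (\<Sum>i\<in>F. s i)) * ln (real (Suc n))"
    by (simp add: A_def algebra_simps del: of_nat_Suc)
  then show False using * by linarith
qed

section \<open>Bounds on finitely many eigenvalues\<close>

text \<open>The squares of the multipliers are the rotation factors of the phases.  They are distinct because
  all multipliers lie in the upper half plane; a product of two of them equals 1 only if
  \<open>e = - cnj e'\<close>, that is \<open>E' = - E\<close>, which the hypothesis on \<open>F\<close> excludes (also for \<open>E = E'\<close>, so that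
  0 does not belong to \<open>F\<close>).\<close>

lemma sum_squares_Im_bloch_le:
  assumes F: "finite F" "F \<subseteq> embedded_eigenvalues V"
    and nonres: "\<And>E E'. E \<in> F \<Longrightarrow> E' \<in> F \<Longrightarrow> E + E' \<noteq> 0"
    and V: "\<forall>\<^sub>F n in sequentially. \<bar>V (Suc n)\<bar> \<le> b / real (Suc n)"
  shows "(\<Sum>E\<in>F. (Im (bloch E))\<^sup>2) \<le> b\<^sup>2 / 2"
proof -
  define t where "t E = Im (bloch E)" for E
  have F2: "E \<in> {-2<..<2}" if "E \<in> F" for E
    using F(2) that by (auto simp: embedded_eigenvalues_def)
  have tpos: "t E > 0" if "E \<in> F" for E
    using Im_bloch_pos[OF F2[OF that]] by (simp add: t_def)
  have "\<forall>E\<in>F. \<exists>R q. amplitude_phase V E R q"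
    using F(2) by (blast intro: embedded_eigenvalue_amplitude_phase[OF _ V])
  then obtain R q where Rq: "\<And>E. E \<in> F \<Longrightarrow> amplitude_phase V E (R E) (q E)" by metis
  have R: "\<And>E n. E \<in> F \<Longrightarrow> R E n > 0" "\<And>E. E \<in> F \<Longrightarrow> summable (R E)"
    and q: "\<And>E. E \<in> F \<Longrightarrow> rotates ((bloch E)\<^sup>2) (q E)"
    and d: "\<And>E. E \<in> F \<Longrightarrow>
      summable (\<lambda>n. ln (R E (Suc n)) - ln (R E n) + V (Suc n) / t E * Im (q E n))"
    using Rq unfolding amplitude_phase_def t_def by blast+
  have inj: "inj_on (\<lambda>E. (bloch E)\<^sup>2) F"
  proof (rule inj_onI)
    fix E E' assume "E \<in> F" "E' \<in> F" "(bloch E)\<^sup>2 = (bloch E')\<^sup>2"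
    then have "bloch E = bloch E' \<or> bloch E = - bloch E'" by (simp add: power2_eq_iff)
    moreover have "bloch E \<noteq> - bloch E'"
      using tpos[OF \<open>E \<in> F\<close>] tpos[OF \<open>E' \<in> F\<close>] by (auto simp: t_def complex_eq_iff)
    ultimately show "E = E'" by (simp add: bloch_def)
  qed
  have res: "(bloch E)\<^sup>2 * (bloch E')\<^sup>2 \<noteq> 1" if EE: "E \<in> F" "E' \<in> F" for E E'
  proof
    assume inv: "(bloch E)\<^sup>2 * (bloch E')\<^sup>2 = 1"
    have "bloch E' * cnj (bloch E') = 1"
      using norm_bloch[OF F2[OF EE(2)]] complex_norm_square[of "bloch E'"] by simp
    then have "(bloch E)\<^sup>2 = (bloch E)\<^sup>2 * (bloch E' * cnj (bloch E'))\<^sup>2" by simp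
    also have "\<dots> = (cnj (bloch E'))\<^sup>2"
      unfolding power_mult_distrib by (simp only: inv mult_1_left flip: mult.assoc)
    finally have "(bloch E)\<^sup>2 = (cnj (bloch E'))\<^sup>2" .
    then have "bloch E = cnj (bloch E') \<or> bloch E = - cnj (bloch E')" by (simp add: power2_eq_iff)
    moreover have "bloch E \<noteq> cnj (bloch E')"
      using tpos[OF EE(1)] tpos[OF EE(2)] by (auto simp: t_def complex_eq_iff)
    ultimately have "bloch E = - cnj (bloch E')" by blast
    then have "Re (bloch E) = Re (- cnj (bloch E'))" by (rule arg_cong)
    then have "E + E' = 0" by (simp add: bloch_def)
    then show False using nonres[OF EE] by blast
  qed
  define S where "S = (\<Sum>E\<in>F. (t E)\<^sup>2)"
  define f where "f n = (\<Sum>E\<in>F. t E * Im (q E n))" for n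
  \<comment> \<open>The weight 1 of \<open>f\<^sup>2\<close> against \<open>b\<^sup>2/4\<close> is optimal: the mean of \<open>f\<^sup>2\<close> is \<open>S/2\<close>, which equals
      \<open>b\<^sup>2/4\<close> in the extremal case \<open>S = b\<^sup>2/2\<close>.\<close>
  have "(\<Sum>E\<in>F. (t E)\<^sup>2) \<le> S / 2 + b\<^sup>2 / 4"
  proof (rule sum_weights_le_of_decaying_amplitudes
      [where R=R and d="\<lambda>E n. V (Suc n) / t E * Im (q E n)"
        and g="\<lambda>n. ((f n)\<^sup>2 + b\<^sup>2 / 4) / real (Suc n)"])
    show "\<forall>\<^sub>F n in sequentially. (\<Sum>E\<in>F. (t E)\<^sup>2 * (V (Suc n) / t E * Im (q E n)))
        \<le> ((f n)\<^sup>2 + b\<^sup>2 / 4) / real (Suc n)"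
      using V
    proof eventually_elim
      case (elim n)
      have "(\<Sum>E\<in>F. (t E)\<^sup>2 * (V (Suc n) / t E * Im (q E n))) = V (Suc n) * f n"
        unfolding f_def sum_distrib_left
        using tpos by (intro sum.cong) (auto simp: power2_eq_square field_simps)
      also have "\<dots> \<le> \<bar>V (Suc n)\<bar> * \<bar>f n\<bar>" by (metis abs_ge_self abs_mult)
      also have "\<dots> \<le> b / real (Suc n) * \<bar>f n\<bar>" using elim by (rule mult_right_mono) simp
      also have "\<dots> = (b * \<bar>f n\<bar>) / real (Suc n)" by simp
      also have "b * \<bar>f n\<bar> \<le> (f n)\<^sup>2 + b\<^sup>2 / 4"
        using sum_squares_bound[of "\<bar>f n\<bar>" "b / 2"] by (simp add: power_divide mult.commute)
      finally show ?case by (simp add: divide_right_mono)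
    qed
    have "summable (\<lambda>n. ((f n)\<^sup>2 - S / 2) / real (Suc n))"
      unfolding f_def S_def by (rule summable_square_of_combination[OF F(1) q inj res])
    then show "summable (\<lambda>n. ((f n)\<^sup>2 + b\<^sup>2 / 4) / real (Suc n) - (S / 2 + b\<^sup>2 / 4) / real (Suc n))"
      by (simp add: add_divide_distrib diff_divide_distrib del: of_nat_Suc)
  qed (use F(1) R d in simp_all)
  then show ?thesis by (simp add: S_def t_def)
qed

text \<open>At \<open>E = 0\<close> the squared phase rotates by \<open>-1\<close> and its square by 1, so that \<open>(Im q)\<^sup>2\<close> need not
  average to \<open>1/2\<close>.  The bound \<open>|Im q| \<le> 1\<close> takes the place of orthogonality.\<close>

lemma one_le_if_zero_embedded_eigenvalue:
  assumes "0 \<in> embedded_eigenvalues V"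
    and V: "\<forall>\<^sub>F n in sequentially. \<bar>V (Suc n)\<bar> \<le> b / real (Suc n)"
  shows "1 \<le> b"
proof -
  obtain R q where R: "\<And>n. R n > 0" "summable R" and q: "rotates ((bloch 0)\<^sup>2) q"
    and d: "summable (\<lambda>n. ln (R (Suc n)) - ln (R n) + V (Suc n) / Im (bloch 0) * Im (q n))"
    using embedded_eigenvalue_amplitude_phase[OF assms] unfolding amplitude_phase_def by blast
  have "(\<Sum>i\<in>{()}. (\<lambda>_. 1) i) \<le> b"
  proof (rule sum_weights_le_of_decaying_amplitudes[where R="\<lambda>_. R" and g="\<lambda>n. b / real (Suc n)"
        and d="\<lambda>_ n. V (Suc n) / Im (bloch 0) * Im (q n)"])
    show "\<forall>\<^sub>F n in sequentially.
        (\<Sum>i\<in>{()}. 1 * (V (Suc n) / Im (bloch 0) * Im (q n))) \<le> b / real (Suc n)"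
      using V
    proof eventually_elim
      case (elim n)
      have "\<bar>Im (q n)\<bar> \<le> 1" using abs_Im_le_cmod[of "q n"] q by (simp add: rotates_def)
      then have "\<bar>V (Suc n)\<bar> * \<bar>Im (q n)\<bar> \<le> \<bar>V (Suc n)\<bar> * 1"
        by (rule mult_left_mono) simp
      then have "V (Suc n) * Im (q n) \<le> b / real (Suc n)"
        using elim abs_ge_self[of "V (Suc n) * Im (q n)"] unfolding abs_mult by linarith
      then show ?case by (simp add: bloch_def)
    qed
  qed (use R d in auto)
  then show ?thesis by simp
qed

lemma sum_over_finite_embedded_eigenvalues_le:
  assumes lim: "limsup (\<lambda>n. ereal (real n * \<bar>V n\<bar>)) = ereal a"
    and F: "finite F" "F \<subseteq> embedded_eigenvalues V"
  shows "(\<Sum>E\<in>F. 4 - E\<^sup>2) \<le> 4 * a\<^sup>2 + 4 * min 1 a"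
proof -
  have a0: "0 \<le> a"
  proof -
    have "0 \<le> limsup (\<lambda>n. ereal (real n * \<bar>V n\<bar>))" by (rule le_Limsup) auto
    then show ?thesis using lim by simp
  qed
  have ev: "\<forall>\<^sub>F n in sequentially. \<bar>V (Suc n)\<bar> \<le> b / real (Suc n)" if "b > a" for b
  proof -
    have "\<forall>\<^sub>F n in sequentially. ereal (real n * \<bar>V n\<bar>) < ereal b"
      using that lim by (intro Limsup_lessD) simp
    then have "\<forall>\<^sub>F n in sequentially. real (Suc n) * \<bar>V (Suc n)\<bar> < b"
      by (subst eventually_sequentially_Suc) simp
    then show ?thesis
      by eventually_elim (simp add: field_simps)
  qed
  have half: "(\<Sum>E\<in>G. 4 - E\<^sup>2) \<le> 2 * a\<^sup>2"
    if G: "G \<subseteq> F" "\<And>E E'. E \<in> G \<Longrightarrow> E' \<in> G \<Longrightarrow> E + E' \<noteq> 0" for G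
  proof -
    have finG: "finite G" "G \<subseteq> embedded_eigenvalues V" using F G(1) finite_subset by auto
    have "(\<Sum>E\<in>G. 4 - E\<^sup>2) = 4 * (\<Sum>E\<in>G. (Im (bloch E))\<^sup>2)"
      unfolding sum_distrib_left
      using finG(2) by (intro sum.cong) (auto simp: embedded_eigenvalues_def Im_bloch_squared)
    moreover have "(\<Sum>E\<in>G. (Im (bloch E))\<^sup>2) \<le> b\<^sup>2 / 2" if "b > a" for b
      by (rule sum_squares_Im_bloch_le[OF finG G(2) ev[OF that]])
    ultimately have *: "(\<Sum>E\<in>G. 4 - E\<^sup>2) \<le> 2 * b\<^sup>2" if "b > a" for b
      using that by fastforce
    have "((\<lambda>b. 2 * b\<^sup>2) \<longlongrightarrow> 2 * a\<^sup>2) (at_right a)"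
      by (intro tendsto_intros)
    then show ?thesis
      by (rule tendsto_lowerbound) (auto intro!: eventually_at_rightI[of a "a + 1"] *)
  qed
  have pos: "(\<Sum>E\<in>F \<inter> {0<..}. 4 - E\<^sup>2) \<le> 2 * a\<^sup>2"
    by (rule half) (auto dest: add_pos_pos)
  have neg: "(\<Sum>E\<in>F \<inter> {..<0}. 4 - E\<^sup>2) \<le> 2 * a\<^sup>2"
    by (rule half) (auto dest: add_neg_neg)
  have zero: "(\<Sum>E\<in>F \<inter> {0}. 4 - E\<^sup>2) \<le> 4 * min 1 a"
  proof (cases "0 \<in> F")
    case True
    then have "1 \<le> b" if "b > a" for b
      using one_le_if_zero_embedded_eigenvalue[OF _ ev[OF that]] F(2) by blast
    then have "1 \<le> a" by (rule dense_ge)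
    then show ?thesis using True by simp
  next
    case False
    then show ?thesis using a0 by simp
  qed
  have split: "F \<inter> {0<..} \<union> F \<inter> {..<0} \<union> F \<inter> {0} = F" by auto
  have "(\<Sum>E\<in>F \<inter> {0<..} \<union> F \<inter> {..<0} \<union> F \<inter> {0}. 4 - E\<^sup>2)
      = (\<Sum>E\<in>F \<inter> {0<..} \<union> F \<inter> {..<0}. 4 - E\<^sup>2) + (\<Sum>E\<in>F \<inter> {0}. 4 - E\<^sup>2)"
    using F(1) by (intro sum.union_disjoint) auto
  moreover have "(\<Sum>E\<in>F \<inter> {0<..} \<union> F \<inter> {..<0}. 4 - E\<^sup>2)
      = (\<Sum>E\<in>F \<inter> {0<..}. 4 - E\<^sup>2) + (\<Sum>E\<in>F \<inter> {..<0}. 4 - E\<^sup>2)"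
    using F(1) by (intro sum.union_disjoint) auto
  ultimately show ?thesis using pos neg zero unfolding split by linarith
qed

section \<open>The eigenvalue sum\<close>

text \<open>If \<open>f\<close> were positive at a limit point, it would exceed a fixed positive number at infinitely many
  points of \<open>P\<close>, and the finite sums would be unbounded.\<close>

lemma nonpos_at_limit_point_of_bounded_finite_sums:
  fixes f :: "'a::t2_space \<Rightarrow> real"
  assumes cont: "isCont f x" and lim: "x islimpt P"
    and bound: "\<And>F. finite F \<Longrightarrow> F \<subseteq> P \<Longrightarrow> sum f F \<le> M"
  shows "f x \<le> 0"
proof (rule ccontr)
  assume "\<not> f x \<le> 0"
  then have "f x / 2 < f x" by simp
  moreover have "(f \<longlongrightarrow> f x) (nhds x)"
    using cont by (simp add: isCont_def tendsto_at_iff_tendsto_nhds)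
  ultimately have "\<forall>\<^sub>F y in nhds x. f x / 2 < f y" by (blast intro: order_tendstoD(1))
  then obtain U where U: "open U" "x \<in> U" "\<And>y. y \<in> U \<Longrightarrow> f x / 2 < f y"
    unfolding eventually_nhds by blast
  have "infinite (U \<inter> P)" using lim U(1,2) by (auto simp: islimpt_eq_acc_point)
  obtain k :: nat where k: "M < real k * (f x / 2)"
    using reals_Archimedean3[of "f x / 2"] \<open>\<not> f x \<le> 0\<close> by auto
  obtain B where B: "finite B" "card B = k" "B \<subseteq> U \<inter> P"
    using infinite_arbitrarily_large[OF \<open>infinite (U \<inter> P)\<close>] by blast
  have "real k * (f x / 2) \<le> sum f B"
    using sum_bounded_below[of B "f x / 2" f] B U(3) by (auto intro: less_imp_le)
  also have "\<dots> \<le> M" using bound B by auto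
  finally show False using k by simp
qed

theorem theorem2p11:
  fixes V :: "nat \<Rightarrow> real" and a :: real
  assumes "limsup (\<lambda>n. ereal (real n * \<bar>V n\<bar>)) = ereal a"
  shows "countable (embedded_eigenvalues V)
    \<and> (\<forall>x. x islimpt embedded_eigenvalues V \<longrightarrow> x = 2 \<or> x = -2)
    \<and> (\<lambda>E. 4 - E\<^sup>2) summable_on embedded_eigenvalues V
    \<and> (\<Sum>\<^sub>\<infinity>E\<in>embedded_eigenvalues V. 4 - E\<^sup>2) \<le> 4 * a\<^sup>2 + 4 * min 1 a"
proof -
  let ?P = "embedded_eigenvalues V"
  have pos: "4 - E\<^sup>2 > 0" if "E \<in> ?P" for E
  proof -
    have E: "E \<in> {-2<..<2}" using that by (simp add: embedded_eigenvalues_def)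
    have "0 < (Im (bloch E))\<^sup>2" using Im_bloch_pos[OF E] by simp
    then show ?thesis using Im_bloch_squared[OF E] by linarith
  qed
  note bound = sum_over_finite_embedded_eigenvalues_le[OF assms]
  have sum: "(\<lambda>E. 4 - E\<^sup>2) summable_on ?P"
  proof (rule nonneg_bounded_partial_sums_imp_summable_on)
    show "4 - E\<^sup>2 \<ge> 0" if "E \<in> ?P" for E using pos[OF that] by simp
    show "\<forall>\<^sub>F F in finite_subsets_at_top ?P. (\<Sum>E\<in>F. 4 - E\<^sup>2) \<le> 4 * a\<^sup>2 + 4 * min 1 a"
      by (rule eventually_finite_subsets_at_top_weakI) (rule bound)
  qed
  have "?P \<subseteq> {E \<in> ?P. 4 - E\<^sup>2 \<noteq> 0}"
    using pos by (intro subsetI CollectI conjI) (auto dest: less_imp_neq)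
  then have count: "countable ?P"
    using summable_countable_real[OF sum] by (rule countable_subset)
  have acc: "x = 2 \<or> x = -2" if x: "x islimpt ?P" for x
  proof -
    have "4 - x\<^sup>2 \<le> 0"
      by (rule nonpos_at_limit_point_of_bounded_finite_sums[where f="\<lambda>E. 4 - E\<^sup>2", OF _ x bound])
        (auto intro!: continuous_intros)
    moreover have "?P \<subseteq> {-2..2}" by (auto simp: embedded_eigenvalues_def)
    then have "x \<in> {-2..2}"
      using closed_limpt[of "{-2..2::real}"] islimpt_subset[OF x] by blast
    ultimately show ?thesis
      using abs_le_square_iff[of 2 x] by auto
  qed
  show ?thesis
    by (intro conjI allI impI count acc sum infsum_le_finite_sums[OF sum bound])
qed

end
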